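(* Let $r>1$ and let $H$ be an $r$-uniform good forest, and denote by $\Delta(H)$ the maximal degree of a vertex in $H$. Then $\mathrm{pmd}(H)=\Delta(H)$.
   Context: A hypergraph is $r$-uniform if every edge has exactly $r$ vertices. An $r$-uniform hypergraph $H=(V,E)$ with $m=|E|$ is a good forest if its edges can be ordered $e_1,\dots,e_m$ so that $|(e_1\cup\dots\cup e_i)\cap e_{i+1}|\le1$ for all $1\le i\le m-1$. The degree of a vertex is the number of edges containing it. A matching is a set of pairwise disjoint edges. A positive matching of $(V,E)$ is a matching $M\subseteq E$ for which there is $w:V\to\mathbb{Q}$ with $\sum_{i\in e}w(i)>0$ for $e\in M$ and $\sum_{i\in e}w(i)<0$ for $e\in E\setminus M$. A positive matching decomposition of $H$ is a partition $E=\bigcup_{i=1}^pM_i$ into pairwise disjoint subsets such that $M_i$ is a positive matching on $(V,E\setminus\bigcup_{j=1}^{i-1}M_j)$ for $i=1,\dots,p$. The smallest such $p$ is denoted $\mathrm{pmd}(H)$. *)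

theory Defs
  imports Complex_Main "HOL-Library.Disjoint_Sets"
begin

definition uniform_hypergraph :: "nat \<Rightarrow> 'a set \<Rightarrow> 'a set set \<Rightarrow> bool" where
  "uniform_hypergraph r V E \<longleftrightarrow> (\<forall>e\<in>E. e \<subseteq> V \<and> finite e \<and> card e = r)"

text \<open>
  The list \<open>es\<close> orders the edges. List positions start at 0, so \<open>es ! i\<close> is the edge
  \<open>e\<^sub>i\<^sub>+\<^sub>1\<close> and \<open>take i es\<close> consists of \<open>e\<^sub>1, \<dots>, e\<^sub>i\<close>. The hypergraph without edges is a
  good forest. The edge set of a good forest is necessarily finite.
\<close>

definition good_forest :: "nat \<Rightarrow> 'a set \<Rightarrow> 'a set set \<Rightarrow> bool" where
  "good_forest r V E \<longleftrightarrow> uniform_hypergraph r V E \<and>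
     (\<exists>es. distinct es \<and> set es = E \<and>
        (\<forall>i. 1 \<le> i \<and> i < length es \<longrightarrow> card (\<Union>(set (take i es)) \<inter> es ! i) \<le> 1))"

definition degree :: "'a set set \<Rightarrow> 'a \<Rightarrow> nat" where
  "degree E v = card {e \<in> E. v \<in> e}"

text \<open>
  When \<open>E\<close> is finite the degrees are bounded, so this supremum is a maximum if \<open>V\<close> is nonempty;
  for empty \<open>V\<close> it is 0.
\<close>

definition max_degree :: "'a set \<Rightarrow> 'a set set \<Rightarrow> nat" where
  "max_degree V E = (SUP v\<in>V. degree E v)"

definition matching :: "'a set set \<Rightarrow> 'a set set \<Rightarrow> bool" where
  "matching E M \<longleftrightarrow> M \<subseteq> E \<and> disjoint M"

text \<open>
  The weight function is total on the type; since every edge is contained in the vertex set, its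
  values elsewhere play no role. For the same reason the vertex set is not a parameter of this
  and the following notions.
\<close>

definition positive_matching :: "'a set set \<Rightarrow> 'a set set \<Rightarrow> bool" where
  "positive_matching E M \<longleftrightarrow> matching E M \<and>
     (\<exists>w :: 'a \<Rightarrow> rat. (\<forall>e\<in>M. (\<Sum>i\<in>e. w i) > 0) \<and> (\<forall>e\<in>E - M. (\<Sum>i\<in>e. w i) < 0))"

definition positive_matching_decomposition ::
    "'a set set \<Rightarrow> nat \<Rightarrow> (nat \<Rightarrow> 'a set set) \<Rightarrow> bool" where
  "positive_matching_decomposition E p M \<longleftrightarrow>
     E = (\<Union>i\<in>{1..p}. M i) \<and> disjoint_family_on M {1..p} \<and>
     (\<forall>i\<in>{1..p}. positive_matching (E - (\<Union>j\<in>{1..<i}. M j)) (M i))"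

text \<open>
  A finite uniform hypergraph with \<open>r \<ge> 1\<close> has a decomposition into single edges (give weight 1
  to the vertices of the chosen edge and weight \<open>- r\<close> to all others), so the minimum exists.
\<close>

definition pmd :: "'a set set \<Rightarrow> nat" where
  "pmd E = (LEAST p. \<exists>M. positive_matching_decomposition E p M)"

end

theory Submission
  imports Defs
begin

text \<open>
  The edges meeting at a vertex of maximal degree lie in different matchings, so at least
  \<open>\<Delta>(H)\<close> matchings are needed (\<open>degree_le_decomposition_length\<close>).

  For the converse, add the edges one at a time in the order given by the good forest. A new edge
  \<open>e\<close> meets the old ones in at most one vertex, and this is used twice.

  Since \<open>r > 1\<close>, the edge \<open>e\<close> has a vertex outside all older edges. The weight of that vertex
  can be chosen to give \<open>e\<close> any prescribed total without changing the total of an older edge.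
  Hence edge totals are arbitrary (\<open>good_forest_edge_sums\<close>), and positivity is no constraint:
  every partition into matchings is a positive matching decomposition.

  Moreover, all older edges meeting \<open>e\<close> pass through a single vertex \<open>v\<close>, and together with
  \<open>e\<close> there are at most \<open>\<Delta>(H)\<close> edges at \<open>v\<close>. So one of \<open>\<Delta>(H)\<close> colours is still free for
  \<open>e\<close>, and greedy colouring partitions \<open>E\<close> into \<open>\<Delta>(H)\<close> matchings
  (\<open>good_forest_edge_colouring\<close>).
\<close>

lemma good_forest_finite: "good_forest r V E \<Longrightarrow> finite E"
  unfolding good_forest_def by auto

lemma good_forest_edge:
  assumes "good_forest r V E" "e \<in> E"
  shows "e \<subseteq> V" "finite e" "card e = r"
  using assms unfolding good_forest_def uniform_hypergraph_def by auto

text \<open>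
  This turns the edge order into an induction on the edge set. The statement proved along the
  order is about the prefixes of the edge list, with the empty prefix covering the first edge.
\<close>

lemma good_forest_induct [consumes 1, case_names empty insert]:
  assumes "good_forest r V E"
    and empty: "P {}"
    and insert: "\<And>F e. \<lbrakk>finite F; e \<notin> F; finite e; card e = r;
      card (\<Union>F \<inter> e) \<le> 1; P F\<rbrakk> \<Longrightarrow> P (insert e F)"
  shows "P E"
proof -
  from assms(1) obtain es where es: "distinct es" "set es = E"
      "\<forall>i. 1 \<le> i \<and> i < length es \<longrightarrow> card (\<Union>(set (take i es)) \<inter> es ! i) \<le> 1"
    unfolding good_forest_def by blast
  have "i \<le> length es \<Longrightarrow> P (set (take i es))" for i
  proof (induction i)
    case 0
    then show ?case using empty by simp
  next
    case (Suc i)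
    let ?F = "set (take i es)"
    have i: "i < length es" using Suc.prems by simp
    have "es ! i \<in> E" using i es(2) by auto
    moreover have "?F \<subseteq> E" using es(2) set_take_subset[of i es] by blast
    moreover have "es ! i \<notin> ?F"
      using es(1) i by (auto simp: in_set_conv_nth nth_eq_iff_index_eq)
    moreover have "card (\<Union>?F \<inter> es ! i) \<le> 1"
      using es(3) i by (cases "i = 0") auto
    ultimately have "P (insert (es ! i) ?F)"
      using Suc good_forest_edge[OF assms(1)] by (intro insert) auto
    then show ?case using i by (simp add: take_Suc_conv_app_nth)
  qed
  from this[of "length es"] show ?thesis using es(2) by simp
qed

text \<open>
  A new edge has a vertex in no older edge, and its weight can be set last. In terms of linear
  algebra, the incidence vectors of the edges are linearly independent.
\<close>

lemma good_forest_edge_sums: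
  fixes s :: "'a set \<Rightarrow> 'b::ab_group_add"
  assumes "good_forest r V E" "r > 1"
  shows "\<exists>w. \<forall>e\<in>E. sum w e = s e"
  using assms(1)
proof (induction rule: good_forest_induct)
  case empty
  then show ?case by simp
next
  case (insert F e)
  then obtain w where w: "\<forall>f\<in>F. sum w f = s f" by blast
  have "e \<noteq> \<Union>F \<inter> e" using insert.hyps assms(2) by auto
  then obtain u where u: "u \<in> e" "u \<notin> \<Union>F" by blast
  define w' where "w' = w(u := s e - sum w (e - {u}))"
  have unchanged: "sum w' A = sum w A" if "u \<notin> A" for A
    using that by (auto simp: w'_def intro!: sum.cong)
  have "sum w' e = w' u + sum w' (e - {u})"
    using insert.hyps u(1) by (simp add: sum.remove)
  also have "\<dots> = s e" by (simp add: unchanged) (simp add: w'_def)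
  finally have "sum w' e = s e" .
  moreover have "sum w' f = s f" if "f \<in> F" for f
    using that u(2) w unchanged[of f] by auto
  ultimately show ?case by (intro exI[of _ w']) auto
qed

text \<open>
  Greedy colouring in the order of the forest: the coloured edges that meet the next edge \<open>e\<close> all
  contain the same vertex of \<open>e\<close>, so there are fewer of them than colours.
\<close>

lemma good_forest_edge_colouring:
  assumes "good_forest r V E" "r > 0" "\<forall>v\<in>\<Union>E. degree E v \<le> k"
  shows "\<exists>c. c ` E \<subseteq> {1..k} \<and> (\<forall>e\<in>E. \<forall>f\<in>E. e \<noteq> f \<longrightarrow> e \<inter> f \<noteq> {} \<longrightarrow> c e \<noteq> c f)"
  using assms(1,3)
proof (induction rule: good_forest_induct)
  case empty
  then show ?case by simp
next
  case (insert F e)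
  have "\<forall>v\<in>\<Union>F. degree F v \<le> k"
  proof
    fix v assume v: "v \<in> \<Union>F"
    have "degree F v \<le> degree (insert e F) v"
      unfolding degree_def using insert.hyps by (intro card_mono) auto
    also have "\<dots> \<le> k" using insert.prems v by auto
    finally show "degree F v \<le> k" .
  qed
  from insert.IH[OF this] obtain c where c: "c ` F \<subseteq> {1..k}"
      "\<forall>e\<in>F. \<forall>f\<in>F. e \<noteq> f \<longrightarrow> e \<inter> f \<noteq> {} \<longrightarrow> c e \<noteq> c f"
    by (elim exE conjE)
  \<comment> \<open>If \<open>e\<close> meets no older edge, any vertex of \<open>e\<close> serves as \<open>v\<close>; the degree bound at \<open>v\<close> then
    guarantees that there is at least one colour.\<close>
  obtain v where v: "v \<in> e" "\<Union>F \<inter> e \<subseteq> {v}"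
  proof (cases "\<Union>F \<inter> e = {}")
    case True
    have "e \<noteq> {}" using insert.hyps assms(2) by auto
    then show ?thesis using True that by blast
  next
    case False
    moreover have "finite (\<Union>F \<inter> e)" using insert.hyps by simp
    ultimately have "card (\<Union>F \<inter> e) = 1"
      using insert.hyps(5) by (simp add: le_Suc_eq)
    then obtain x where "\<Union>F \<inter> e = {x}" by (auto simp: card_1_singleton_iff)
    then show ?thesis using that[of x] by blast
  qed
  define D where "D = {f \<in> F. v \<in> f}"
  have D: "finite D" "e \<notin> D" using insert.hyps by (auto simp: D_def)
  have "{f \<in> insert e F. v \<in> f} = insert e D" using v(1) by (auto simp: D_def)
  then have "degree (insert e F) v = Suc (card D)" using D by (simp add: degree_def)
  moreover have "degree (insert e F) v \<le> k" using insert.prems v(1) by simp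
  ultimately have "card D < k" by linarith
  then have "card (c ` D) < card {1..k}"
    using card_image_le[OF D(1), of c] by simp
  then obtain q where q: "q \<in> {1..k}" "q \<notin> c ` D"
    using card_mono[of "c ` D" "{1..k}"] D(1) by (meson finite_imageI not_le subsetI)
  have "c f \<noteq> q" if "f \<in> F" "e \<inter> f \<noteq> {}" for f
    using that v(2) q(2) by (auto simp: D_def)
  then show ?case
    using c q(1) insert.hyps(2) by (intro exI[of _ "c(e := q)"]) (auto simp: Int_commute)
qed

lemma matching_unique_edge:
  "\<lbrakk>matching E M; e \<in> M; f \<in> M; v \<in> e; v \<in> f\<rbrakk> \<Longrightarrow> e = f"
  unfolding matching_def disjoint_def by blast

lemma degree_le_decomposition_length:
  assumes "positive_matching_decomposition E p M"
  shows "degree E v \<le> p"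
proof -
  have one: "card {e \<in> M i. v \<in> e} \<le> 1" if "i \<in> {1..p}" for i
  proof -
    from assms that obtain F where "matching F (M i)"
      unfolding positive_matching_decomposition_def positive_matching_def by blast
    then have "e = f" if "e \<in> M i" "f \<in> M i" "v \<in> e" "v \<in> f" for e f
      using matching_unique_edge that by metis
    then obtain x where "{e \<in> M i. v \<in> e} \<subseteq> {x}"
      by (cases "{e \<in> M i. v \<in> e} = {}") auto
    then show ?thesis using card_mono[of "{x}"] by simp
  qed
  have "{e \<in> E. v \<in> e} = (\<Union>i\<in>{1..p}. {e \<in> M i. v \<in> e})"
    using assms unfolding positive_matching_decomposition_def by auto
  then have "degree E v \<le> (\<Sum>i\<in>{1..p}. card {e \<in> M i. v \<in> e})"
    unfolding degree_def by (simp add: card_UN_le)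
  also have "\<dots> \<le> (\<Sum>i\<in>{1..p}. 1)" using one by (intro sum_mono)
  finally show ?thesis by simp
qed

text \<open>
  The weights for a colour class can be chosen with respect to all of \<open>E\<close> at once, so the order in
  which the classes are removed does not matter.
\<close>

lemma good_forest_decomposition:
  assumes "good_forest r V E" "r > 1" "\<forall>v\<in>\<Union>E. degree E v \<le> k"
  shows "\<exists>M. positive_matching_decomposition E k M"
proof -
  obtain c where c: "c ` E \<subseteq> {1..k}"
      "\<forall>e\<in>E. \<forall>f\<in>E. e \<noteq> f \<longrightarrow> e \<inter> f \<noteq> {} \<longrightarrow> c e \<noteq> c f"
    using good_forest_edge_colouring[OF assms(1) _ assms(3)] assms(2) by auto
  define M where "M i = {e \<in> E. c e = i}" for i
  have "positive_matching (E - (\<Union>j\<in>{1..<i}. M j)) (M i)" for i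
  proof -
    obtain w :: "'a \<Rightarrow> rat" where "\<forall>e\<in>E. sum w e = (if e \<in> M i then 1 else - 1)"
      using good_forest_edge_sums[OF assms(1,2), of "\<lambda>e. if e \<in> M i then 1 else - 1"] by auto
    then have "(\<forall>e\<in>M i. sum w e > 0) \<and> (\<forall>e\<in>(E - (\<Union>j\<in>{1..<i}. M j)) - M i. sum w e < 0)"
      by (auto simp: M_def)
    moreover have "matching (E - (\<Union>j\<in>{1..<i}. M j)) (M i)"
      using c(2) by (auto simp: matching_def disjoint_def M_def)
    ultimately show ?thesis unfolding positive_matching_def by blast
  qed
  moreover have "E = (\<Union>i\<in>{1..k}. M i)" using c(1) by (auto simp: M_def)
  moreover have "disjoint_family_on M {1..k}" by (auto simp: disjoint_family_on_def M_def)
  ultimately show ?thesis unfolding positive_matching_decomposition_def by blast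
qed

theorem corollary3p1:
  fixes r :: nat and V :: "'a set" and E :: "'a set set"
  assumes "r > 1" and "good_forest r V E"
  shows "pmd E = max_degree V E"
  unfolding pmd_def
proof (rule Least_equality)
  have fin: "finite E" using assms(2) by (rule good_forest_finite)
  have "degree E v \<le> card E" for v
    unfolding degree_def using fin by (intro card_mono) auto
  then have bdd: "bdd_above (degree E ` V)"
    by (intro bdd_aboveI[of _ "card E"]) (elim imageE, simp)
  have "degree E v \<le> max_degree V E" if "v \<in> \<Union>E" for v
    unfolding max_degree_def
    using good_forest_edge(1)[OF assms(2)] that by (intro cSUP_upper bdd) auto
  then show "\<exists>M. positive_matching_decomposition E (max_degree V E) M"
    using good_forest_decomposition[OF assms(2,1)] by blast
next
  fix p assume "\<exists>M. positive_matching_decomposition E p M"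
  then obtain M where "positive_matching_decomposition E p M" ..
  then have "degree E v \<le> p" for v by (rule degree_le_decomposition_length)
  then show "max_degree V E \<le> p"
    unfolding max_degree_def by (cases "V = {}") (simp_all add: cSUP_least)
qed

end
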